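(* Let $1\le\alpha\le n$ and $\Sigma=\{0,1,2\}$ with $d(a,b)=|a-b|$. Then every $0.9$-accurate one-way communication protocol for $\mathrm{DTEP}_1^\alpha(\Sigma^{\le n})$ has bit complexity $\Omega(n/\alpha)$.
   Context: A run is a maximal substring of one repeated letter; an expansion is obtained by lengthening runs; a correspondence between $x,y$ is a pair of equal-length expansions $(\bar x,\bar y)$ with cost $\sum_i d(\bar x_i,\bar y_i)$; $\mathrm{DTW}(x,y)$ is the minimum cost. One-way communication: Alice holds $x$, Bob holds $y$; with public randomness Alice sends one message, Bob outputs an answer; $p$-accurate means valid output with probability $\ge p$ for every input pair; bit complexity is maximal message length. $\mathrm{DTEP}_r^\alpha(\Sigma^{\le n})$: inputs $x,y\in\Sigma^{\le n}$; output $0$ is valid if $\mathrm{DTW}(x,y)\le r$ and output $1$ is valid if $\mathrm{DTW}(x,y)>r\alpha$. *)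

theory Defs
  imports "HOL-Probability.Probability"
begin

function runs :: "'a list \<Rightarrow> 'a list list" where
  "runs [] = []"
| "runs (a # x) = (a # takeWhile ((=) a) x) # runs (dropWhile ((=) a) x)"
  by pat_completeness auto
termination
  by (relation "Wellfounded.measure length") (auto simp: le_imp_less_Suc length_dropWhile_le)

definition expansion :: "'a list \<Rightarrow> 'a list \<Rightarrow> bool" where
  "expansion x xb \<longleftrightarrow>
     (\<exists>ss. list_all2 (\<lambda>r s. \<exists>k. s = r @ replicate k (hd r)) (runs x) ss \<and> xb = concat ss)"

definition correspondences :: "'a list \<Rightarrow> 'a list \<Rightarrow> ('a list \<times> 'a list) set" where
  "correspondences x y =
     {(xb, yb). expansion x xb \<and> expansion y yb \<and> length xb = length yb}"

definition corr_cost :: "('a \<Rightarrow> 'a \<Rightarrow> real) \<Rightarrow> 'a list \<times> 'a list \<Rightarrow> real" where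
  "corr_cost d = (\<lambda>(xb, yb). \<Sum>i<length xb. d (xb ! i) (yb ! i))"

text \<open>
  Values are extended reals: if exactly one of the strings is empty there is no
  correspondence, and the distance is \<open>\<infinity>\<close>. In all other cases, for a nonnegative \<open>d\<close>, the
  infimum is attained, i.e. it is the minimum cost.
\<close>

definition DTW :: "('a \<Rightarrow> 'a \<Rightarrow> real) \<Rightarrow> 'a list \<Rightarrow> 'a list \<Rightarrow> ereal" where
  "DTW d x y = (INF c\<in>correspondences x y. ereal (corr_cost d c))"

definition strings_upto :: "'a set \<Rightarrow> nat \<Rightarrow> 'a list set" where
  "strings_upto \<Sigma> n = {x \<in> lists \<Sigma>. length x \<le> n}"

text \<open>
  Alice and Bob share an infinite bit string \<open>\<omega>\<close>, drawn from an arbitrary distribution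
  (independent fair coins being one instance).
\<close>

record ('x, 'y, 'o) one_way_protocol =
  public_rand :: "(nat \<Rightarrow> bool) measure"
  message :: "(nat \<Rightarrow> bool) \<Rightarrow> 'x \<Rightarrow> bool list"
  answer :: "(nat \<Rightarrow> bool) \<Rightarrow> bool list \<Rightarrow> 'y \<Rightarrow> 'o"

text \<open>
  A communication problem is given by the sets of inputs \<open>X\<close>, \<open>Y\<close> and the relation
  \<open>valid x y b\<close>. Nothing is required of the protocol on input pairs without any valid output
  (those violating the promise of a promise problem). Since \<open>measure\<close> is \<open>0\<close> on
  non-measurable sets, a positive lower bound on the probability entails that the success
  event is measurable.
\<close>

definition accurate ::
  "real \<Rightarrow> 'x set \<Rightarrow> 'y set \<Rightarrow> ('x \<Rightarrow> 'y \<Rightarrow> 'o \<Rightarrow> bool) \<Rightarrow> ('x, 'y, 'o) one_way_protocol \<Rightarrow> bool"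
where
  "accurate p X Y valid P \<longleftrightarrow>
     prob_space (public_rand P) \<and>
     (\<forall>x\<in>X. \<forall>y\<in>Y. (\<exists>b. valid x y b) \<longrightarrow>
        measure (public_rand P)
          {\<omega> \<in> space (public_rand P). valid x y (answer P \<omega> (message P \<omega> x) y)} \<ge> p)"

definition bit_complexity :: "'x set \<Rightarrow> ('x, 'y, 'o) one_way_protocol \<Rightarrow> enat" where
  "bit_complexity X P = (SUP \<omega>\<in>space (public_rand P). SUP x\<in>X. enat (length (message P \<omega> x)))"

definition DTEP_valid ::
  "('a \<Rightarrow> 'a \<Rightarrow> real) \<Rightarrow> real \<Rightarrow> real \<Rightarrow> 'a list \<Rightarrow> 'a list \<Rightarrow> nat \<Rightarrow> bool"
where
  "DTEP_valid d r \<alpha> x y b \<longleftrightarrow>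
     (b = 0 \<and> DTW d x y \<le> ereal r) \<or> (b = 1 \<and> DTW d x y > ereal (r * \<alpha>))"

definition DTEP_accurate ::
  "real \<Rightarrow> ('a \<Rightarrow> 'a \<Rightarrow> real) \<Rightarrow> real \<Rightarrow> real \<Rightarrow> 'a set \<Rightarrow> nat \<Rightarrow>
     ('a list, 'a list, nat) one_way_protocol \<Rightarrow> bool"
where
  "DTEP_accurate p d r \<alpha> \<Sigma> n =
     accurate p (strings_upto \<Sigma> n) (strings_upto \<Sigma> n) (DTEP_valid d r \<alpha>)"

end

theory Submission
  imports Defs
begin

text \<open>
  The index problem on \<open>m = \<Theta>(n/\<alpha>)\<close> bits reduces to DTEP. With \<open>L = \<lfloor>\<alpha>\<rfloor> + 1\<close>, Alice encodes bits
  \<open>z\<close> as the string with runs \<open>0 1 2 0 1 2 \<dots>\<close>, where the run of 1s in block \<open>j\<close> has length \<open>L\<close> if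
  \<open>z j\<close> holds, and all other runs have length 1. To query bit \<open>i\<close>, Bob takes the same sequence of runs,
  all of length \<open>L\<close>, with the 1 of block \<open>i\<close> deleted. If Alice's run there is a single letter, it is
  the only mismatch, at cost 1. If it has length \<open>L\<close>, then a correspondence of cost less than \<open>L\<close>
  would match a part of each of Bob's runs and of Alice's long run with equal letters, so Bob's
  sequence of letters would embed in Alice's using that very 1, which is impossible.

  For the index problem, fix the randomness so that Bob errs on at most a tenth of all pairs
  \<open>(z, i)\<close>. If \<open>D z\<close> is the Hamming distance from \<open>z\<close> to Bob's guess for it, then the sum of
  \<open>(1/4)\<^bsup>D z\<^esup>\<close> over all \<open>z\<close> is at least \<open>2\<^sup>m (1/4)\<^bsup>m/10\<^esup>\<close> by convexity, while each message contributes
  at most \<open>(5/4)\<^sup>m\<close>. Hence the number of messages is exponential in \<open>m\<close>.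
\<close>

section \<open>Run-length encodings\<close>

text \<open>Inverse of run-length encoding. Zero counts and equal neighbouring letters are allowed,
  so the pairs describe the runs of the result only for a reduced encoding: positive counts and
  \<open>distinct_adj\<close> letters.\<close>

definition unruns :: "('a \<times> nat) list \<Rightarrow> 'a list" where
  "unruns ps = concat (map (\<lambda>(a, k). replicate k a) ps)"

lemma unruns_Nil [simp]: "unruns [] = []"
  and unruns_Cons [simp]: "unruns ((a, k) # ps) = replicate k a @ unruns ps"
  and unruns_append [simp]: "unruns (ps @ qs) = unruns ps @ unruns qs"
  by (simp_all add: unruns_def)

lemma unruns_eq_Nil_or_hd_unruns:
  "\<forall>p\<in>set ps. 0 < snd p \<Longrightarrow> unruns ps = [] \<or> ps \<noteq> [] \<and> hd (unruns ps) = fst (hd ps)"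
  by (cases ps) (auto simp: hd_append)

lemma runs_unruns:
  assumes "distinct_adj (map fst ps)" "\<forall>p\<in>set ps. 0 < snd p"
  shows "runs (unruns ps) = map (\<lambda>(a, k). replicate k a) ps"
  using assms
proof (induction ps)
  case (Cons p ps)
  obtain a k where p: "p = (a, Suc k)"
    using Cons.prems(2) by (cases p) (auto simp: gr0_conv_Suc)
  have hd: "unruns ps = [] \<or> a \<noteq> hd (unruns ps)"
    using unruns_eq_Nil_or_hd_unruns[of ps] Cons.prems p by (auto simp: distinct_adj_Cons hd_map)
  have "takeWhile ((=) a) (unruns ps) = []" "dropWhile ((=) a) (unruns ps) = unruns ps"
    using hd by (cases "unruns ps"; simp)+
  then have "takeWhile ((=) a) (replicate k a @ unruns ps) = replicate k a"
    "dropWhile ((=) a) (replicate k a @ unruns ps) = unruns ps"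
    by (auto simp: takeWhile_append dropWhile_append)
  moreover have "runs (unruns ps) = map (\<lambda>(a, k). replicate k a) ps"
    using Cons.prems by (intro Cons.IH) (auto dest: distinct_adj_ConsD)
  ultimately show ?case
    by (simp add: p)
qed simp

text \<open>Turns correspondences into pairs of encodings: lengthening runs keeps the letters and
  raises only the counts. Positive counts ensure that \<open>hd\<close> of each run is its
  letter.\<close>

lemma expansion_unruns_iff:
  assumes "distinct_adj (map fst ps)" "\<forall>p\<in>set ps. 0 < snd p"
  shows "expansion (unruns ps) xb \<longleftrightarrow>
    (\<exists>qs. list_all2 (\<lambda>(a, k) (b, l). a = b \<and> k \<le> l) ps qs \<and> xb = unruns qs)"
proof -
  have "(\<exists>ss. list_all2 (\<lambda>r s. \<exists>k. s = r @ replicate k (hd r)) (map (\<lambda>(a, k). replicate k a) ps) ss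
           \<and> xb = concat ss)
      \<longleftrightarrow> (\<exists>qs. list_all2 (\<lambda>(a, k) (b, l). a = b \<and> k \<le> l) ps qs \<and> xb = unruns qs)"
    using assms(2)
  proof (induction ps arbitrary: xb)
    case (Cons p ps)
    obtain a k where p: "p = (a, k)" "0 < k"
      using Cons.prems by (cases p) auto
    have "(\<exists>ss. list_all2 (\<lambda>r s. \<exists>k. s = r @ replicate k (hd r)) (map (\<lambda>(a, k). replicate k a) (p # ps)) ss
           \<and> xb = concat ss) \<longleftrightarrow>
       (\<exists>j xb'. xb = replicate (k + j) a @ xb' \<and>
          (\<exists>ss. list_all2 (\<lambda>r s. \<exists>k. s = r @ replicate k (hd r)) (map (\<lambda>(a, k). replicate k a) ps) ss
           \<and> xb' = concat ss))"
      using p by (fastforce simp: list_all2_Cons1 replicate_add)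
    also have "\<dots> \<longleftrightarrow> (\<exists>j xb'. xb = replicate (k + j) a @ xb' \<and>
        (\<exists>qs. list_all2 (\<lambda>(a, k) (b, l). a = b \<and> k \<le> l) ps qs \<and> xb' = unruns qs))"
      using Cons by simp
    also have "\<dots> \<longleftrightarrow> (\<exists>qs. list_all2 (\<lambda>(a, k) (b, l). a = b \<and> k \<le> l) (p # ps) qs \<and> xb = unruns qs)"
    proof safe
      fix j qs assume "list_all2 (\<lambda>(a, k) (b, l). a = b \<and> k \<le> l) ps qs"
      then show "\<exists>qs'. list_all2 (\<lambda>(a, k) (b, l). a = b \<and> k \<le> l) (p # ps) qs' \<and>
          replicate (k + j) a @ unruns qs = unruns qs'"
        using p by (intro exI[of _ "(a, k + j) # qs"]) simp
    next
      fix qs' assume "list_all2 (\<lambda>(a, k) (b, l). a = b \<and> k \<le> l) (p # ps) qs'"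
      then obtain l qs where "qs' = (a, l) # qs" "k \<le> l"
          "list_all2 (\<lambda>(a, k) (b, l). a = b \<and> k \<le> l) ps qs"
        by (auto simp: list_all2_Cons1 p)
      then show "\<exists>j xb'. unruns qs' = replicate (k + j) a @ xb' \<and>
          (\<exists>qs. list_all2 (\<lambda>(a, k) (b, l). a = b \<and> k \<le> l) ps qs \<and> xb' = unruns qs)"
        by (intro exI[of _ "l - k"] exI[of _ "unruns qs"]) auto
    qed
    finally show ?case .
  qed simp
  then show ?thesis
    by (simp add: expansion_def runs_unruns[OF assms])
qed

section \<open>Compressed letter sequences of filtered strings\<close>

lemma length_remdups_adj_append_le:
  "length (remdups_adj (xs @ ys)) \<le> length (remdups_adj xs) + length (remdups_adj ys)"
proof (cases ys)
  case (Cons y ys')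
  have "length (remdups_adj (xs @ [y])) \<le> Suc (length (remdups_adj xs))"
    by (cases xs rule: rev_cases) (auto simp: remdups_adj_append_two)
  then show ?thesis
    using remdups_adj_append[of xs y ys'] remdups_adj_length_ge1[of ys] by (simp add: Cons)
qed simp

text \<open>Each run stays constant under filtering, hence leaves at most one letter after
  compression. In the application \<open>zs\<close> lists the aligned pairs of letters,
  \<open>f\<close> is a projection and \<open>P\<close> is agreement.\<close>

lemma length_remdups_adj_filter_le:
  assumes "map f zs = unruns ps"
  shows "length (remdups_adj (map f (filter P zs))) \<le> length ps"
  using assms
proof (induction ps arbitrary: zs)
  case (Cons p ps)
  obtain a k where p: "p = (a, k)" by (cases p)
  obtain us vs where zs: "zs = us @ vs" "map f us = replicate k a" "map f vs = unruns ps"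
    using Cons.prems unfolding p unruns_Cons map_eq_append_conv by auto
  have "map f (filter P us) = replicate (length (filter P us)) a"
    using zs(2) by (auto simp: map_replicate_const[symmetric] intro!: map_cong)
       (metis in_set_replicate image_eqI set_map)
  then have "length (remdups_adj (map f (filter P us))) \<le> 1"
    by (simp only: remdups_adj_replicate) auto
  then show ?case
    using Cons.IH[OF zs(3)] length_remdups_adj_append_le[of "map f (filter P us)" "map f (filter P vs)"]
    by (simp add: zs(1))
qed simp

text \<open>Fewer than \<open>L\<close> deletions cannot exhaust a run of length at least
  \<open>L\<close>. So every run survives, and neighbouring runs do not merge because their letters
  differ.\<close>

lemma remdups_adj_filter_unruns:
  assumes "map f zs = unruns ps" "distinct_adj (map fst ps)" "\<forall>p\<in>set ps. L \<le> snd p"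
    and "length (filter (\<lambda>z. \<not> P z) zs) < L"
  shows "remdups_adj (map f (filter P zs)) = map fst ps"
  using assms
proof (induction ps arbitrary: zs)
  case (Cons p ps)
  obtain a k where p: "p = (a, k)" "L \<le> k" using Cons.prems(3) by (cases p) auto
  obtain us vs where zs: "zs = us @ vs" "map f us = replicate k a" "map f vs = unruns ps"
    using Cons.prems(1) unfolding p unruns_Cons map_eq_append_conv by auto
  define j where "j = length (filter P us)"
  have us: "map f (filter P us) = replicate j a"
    using zs(2) by (auto simp: j_def map_replicate_const[symmetric] intro!: map_cong)
       (metis in_set_replicate image_eqI set_map)
  have "length us = k"
    using zs(2) by (metis length_map length_replicate)
  then have "0 < j"
    using Cons.prems(4) p(2) sum_length_filter_compl[of P us]
    unfolding j_def zs(1) filter_append length_append by linarith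
  have vs: "remdups_adj (map f (filter P vs)) = map fst ps"
    using Cons.prems zs by (intro Cons.IH) (auto dest: distinct_adj_ConsD)
  have "map f (filter P vs) = [] \<or> hd (map f (filter P vs)) \<noteq> a"
    using Cons.prems(2) vs p(1)
    by (metis distinct_adj_Cons fst_conv hd_remdups_adj list.simps(9) remdups_adj_Nil_iff)
  then have "remdups_adj (replicate j a @ map f (filter P vs)) = a # map fst ps"
    using \<open>0 < j\<close> vs by (subst remdups_adj_append') (auto simp: remdups_adj_replicate)
  then show ?case
    by (simp add: zs(1) p(1) us)
qed simp

text \<open>
  With fewer than \<open>L\<close> mismatches, the positions where both strings agree meet every run of the
  second string and the distinguished run \<open>(a, k)\<close> of the first. The common substring then has
  letters \<open>map fst qs\<close> up to repetitions, and its \<open>a\<close> sits at an index \<open>i\<close> bounded from above by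
  the number of runs before \<open>(a, k)\<close>, and from below by the number of runs after it.
\<close>

lemma le_mismatches_of_long_run:
  assumes fst: "map fst zs = unruns (ps @ (a, k) # ps')" and "L \<le> k"
    and snd: "map snd zs = unruns qs" "distinct_adj (map fst qs)" "\<forall>q\<in>set qs. L \<le> snd q"
    and a: "\<And>i. i < length qs \<Longrightarrow> i \<le> length ps \<Longrightarrow> length qs \<le> i + length ps' + 1 \<Longrightarrow> fst (qs ! i) \<noteq> a"
  shows "L \<le> length (filter (\<lambda>(b, c). b \<noteq> c) zs)"
proof (rule ccontr)
  let ?P = "\<lambda>(b, c). b = c"
  assume "\<not> L \<le> length (filter (\<lambda>(b, c). b \<noteq> c) zs)"
  then have less: "length (filter (\<lambda>z. \<not> ?P z) zs) < L"
    by (simp add: case_prod_unfold)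
  obtain us vs ws where zs: "zs = us @ vs @ ws" "map fst us = unruns ps"
      "map fst vs = replicate k a" "map fst ws = unruns ps'"
    using fst by (auto simp: map_eq_append_conv append_eq_map_conv)
  have "length vs = k"
    using zs(3) by (metis length_map length_replicate)
  then have "filter ?P vs \<noteq> []"
    using less \<open>L \<le> k\<close> sum_length_filter_compl[of ?P vs] by (auto simp: zs(1))
  moreover have vs_a: "\<forall>z\<in>set vs. fst z = a"
    using arg_cong[OF zs(3), of set] by (auto simp: set_replicate_conv_if split: if_splits)
  ultimately have "(a, a) \<in> set vs"
    by (auto simp: filter_empty_conv)
  then obtain vs1 vs2 where vs: "vs = vs1 @ (a, a) # vs2"
    by (meson split_list)
  \<comment> \<open>The long run is cut at an agreeing pair \<open>(a, a)\<close>, and its parts are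
    counted on both sides; hence the + 1 in both bounds below.\<close>
  define l r where "l = map fst (filter ?P (us @ vs1))" and "r = map fst (filter ?P (vs2 @ ws))"
  have rep: "map fst (vs1 @ [(a, a)]) = replicate (length (vs1 @ [(a, a)])) a"
    "map fst ((a, a) # vs2) = replicate (length ((a, a) # vs2)) a"
    using vs_a unfolding vs by (auto intro!: replicate_eqI simp del: replicate.simps)
  have l: "length (remdups_adj (l @ [a])) \<le> length ps + 1"
    using length_remdups_adj_filter_le[of fst "us @ vs1 @ [(a, a)]" "ps @ [(a, length (vs1 @ [(a, a)]))]" ?P]
      zs(2) rep(1) by (simp add: l_def)
  have r: "length (remdups_adj (a # r)) \<le> length ps' + 1"
    using length_remdups_adj_filter_le[of fst "(a, a) # vs2 @ ws" "(a, length ((a, a) # vs2)) # ps'" ?P]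
      zs(4) rep(2) by (simp add: r_def)
  have "map snd (filter ?P zs) = map fst (filter ?P zs)"
    by auto
  then have "map fst qs = remdups_adj (map fst (filter ?P zs))"
    using remdups_adj_filter_unruns[OF snd less] by metis
  then have qs: "map fst qs = remdups_adj (l @ a # r)"
    by (simp add: zs(1) vs l_def r_def)
  \<comment> \<open>\<open>i\<close> is the index of the marked \<open>a\<close> among the
    compressed common letters, because compressing \<open>l @ [a]\<close> gives a list ending in
    \<open>a\<close>.\<close>
  define i where "i = length (remdups_adj (l @ [a])) - 1"
  have i: "Suc i = length (remdups_adj (l @ [a]))"
    using remdups_adj_length_ge1[of "l @ [a]"] by (simp add: i_def)
  have len: "length qs = i + length (remdups_adj (a # r))"
    using arg_cong[OF qs, of length] i remdups_adj_length_ge1[of "a # r"]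
    by (simp add: remdups_adj_append[of l a r])
  have "i < length qs"
    using len by (cases "remdups_adj (a # r)") auto
  moreover have "remdups_adj (l @ a # r) ! i = last (remdups_adj (l @ [a]))"
    using i by (subst remdups_adj_append, subst last_conv_nth) (auto simp: nth_append i_def)
  ultimately have "fst (qs ! i) = a"
    using qs by (metis last_remdups_adj last_snoc nth_map)
  then show False
    using a[OF \<open>i < length qs\<close>] l r i len by simp
qed

section \<open>Costs of correspondences\<close>

lemma corr_cost_eq_sum_list:
  assumes "length xb = length yb"
  shows "corr_cost d (xb, yb) = (\<Sum>(a, b)\<leftarrow>zip xb yb. d a b)"
  using assms by (auto simp: corr_cost_def sum_list_sum_nth atLeast0LessThan intro!: sum.cong)

lemma corr_cost_append:
  assumes "length xb = length yb" "length xb' = length yb'"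
  shows "corr_cost d (xb @ xb', yb @ yb') = corr_cost d (xb, yb) + corr_cost d (xb', yb')"
  using assms by (simp add: corr_cost_eq_sum_list)

lemma corr_cost_refl: "(\<And>a. d a a = 0) \<Longrightarrow> corr_cost d (xb, xb) = 0"
  by (simp add: corr_cost_def)

lemma mismatches_le_corr_cost:
  fixes d :: "'a \<Rightarrow> 'a \<Rightarrow> real"
  assumes "length xb = length yb" and "\<And>a b. of_bool (a \<noteq> b) \<le> d a b"
  shows "length (filter (\<lambda>(a, b). a \<noteq> b) (zip xb yb)) \<le> corr_cost d (xb, yb)"
proof -
  have "real (length (filter (\<lambda>(a, b). a \<noteq> b) zs)) \<le> (\<Sum>(a, b)\<leftarrow>zs. d a b)" for zs
  proof (induction zs)
    case (Cons z zs)
    then show ?case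
      using assms(2)[of "fst z" "snd z"] by (auto simp: case_prod_unfold)
  qed simp
  then show ?thesis
    by (simp add: corr_cost_eq_sum_list[OF assms(1)])
qed

text \<open>An expansion keeps the letters and the number of runs, and lengths only grow. So the
  hypotheses pass to both strings of any correspondence, where each mismatch costs at least
  1.\<close>

lemma DTW_ge_of_long_run:
  fixes d :: "'a \<Rightarrow> 'a \<Rightarrow> real"
  assumes d: "\<And>a b. of_bool (a \<noteq> b) \<le> d a b"
    and x: "x = unruns (ps @ (a, k) # ps')" "distinct_adj (map fst (ps @ (a, k) # ps'))"
      "\<forall>p\<in>set (ps @ (a, k) # ps'). 0 < snd p" "L \<le> k"
    and y: "y = unruns qs" "distinct_adj (map fst qs)" "\<forall>q\<in>set qs. L \<le> snd q" "0 < L"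
    and a: "\<And>i. i < length qs \<Longrightarrow> i \<le> length ps \<Longrightarrow> length qs \<le> i + length ps' + 1 \<Longrightarrow> fst (qs ! i) \<noteq> a"
  shows "ereal L \<le> DTW d x y"
  unfolding DTW_def
proof (intro INF_greatest)
  fix c assume "c \<in> correspondences x y"
  then obtain xb yb where c: "c = (xb, yb)" "expansion x xb" "expansion y yb" "length xb = length yb"
    by (auto simp: correspondences_def)
  obtain rs where rs: "list_all2 (\<lambda>(a, k) (b, l). a = b \<and> k \<le> l) (ps @ (a, k) # ps') rs" "xb = unruns rs"
    using c(2) unfolding x(1) expansion_unruns_iff[OF x(2,3)] by blast
  obtain us k' us' where us: "rs = us @ (a, k') # us'" "k \<le> k'" "length us = length ps" "length us' = length ps'"
    using rs(1) by (auto simp: list_all2_append1 list_all2_Cons1 dest: list_all2_lengthD)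
  have "\<forall>q\<in>set qs. 0 < snd q"
    using y(3,4) by auto
  then obtain ts where ts: "list_all2 (\<lambda>(a, k) (b, l). a = b \<and> k \<le> l) qs ts" "yb = unruns ts"
    using c(3) y by (auto simp: expansion_unruns_iff)
  have fst_ts: "map fst ts = map fst qs" and len_ts: "length ts = length qs"
    using ts(1) by (auto simp: list_all2_conv_all_nth case_prod_unfold list_eq_iff_nth_eq)
  have "\<forall>t\<in>set ts. L \<le> snd t"
    using ts(1) y(3) by (auto simp: list_all2_conv_all_nth case_prod_unfold all_set_conv_all_nth intro: order_trans)
  then have "L \<le> length (filter (\<lambda>(b, c). b \<noteq> c) (zip xb yb))"
    using c(4) us rs(2) ts(2) y(2) x(4) a fst_ts
    by (intro le_mismatches_of_long_run[where ps = us and ps' = us' and a = a and k = k' and qs = ts])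
      (auto simp: len_ts, metis len_ts nth_map)
  then show "ereal L \<le> ereal (corr_cost d c)"
    using mismatches_le_corr_cost[OF c(4) d] by (simp add: c(1))
qed

section \<open>Encoding the index problem by strings\<close>

definition alice_block :: "nat \<Rightarrow> bool \<Rightarrow> (int \<times> nat) list" where
  "alice_block L b = [(0, 1), (1, if b then L else 1), (2, 1)]"

text \<open>\<open>b\<close> marks the queried block. With three letters, neighbouring runs stay
  different even after the 1 is deleted.\<close>

definition bob_block :: "nat \<Rightarrow> bool \<Rightarrow> (int \<times> nat) list" where
  "bob_block L b = (if b then [(0, L), (2, L)] else [(0, L), (1, L), (2, L)])"

definition alice_string :: "nat \<Rightarrow> nat \<Rightarrow> (nat \<Rightarrow> bool) \<Rightarrow> int list" where
  "alice_string L m z = unruns (concat (map (\<lambda>j. alice_block L (z j)) [0..<m]))"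

definition bob_string :: "nat \<Rightarrow> nat \<Rightarrow> nat \<Rightarrow> int list" where
  "bob_string L m i = unruns (concat (map (\<lambda>j. bob_block L (j = i)) [0..<m]))"

lemma distinct_adj_blocks:
  assumes "\<And>j. map fst (h j) \<in> {[0, 1, 2 :: int], [0, 2]}"
  shows "distinct_adj (map fst (concat (map h js)))"
proof -
  \<comment> \<open>Strengthened for the induction: each block ends in 2, so what follows it must
    start with 0.\<close>
  have "distinct_adj (map fst (concat (map h js))) \<and>
      (map fst (concat (map h js)) = [] \<or> hd (map fst (concat (map h js))) = 0)"
  proof (induction js)
    case (Cons j js)
    then show ?case
      using assms[of j] by (auto simp: distinct_adj_Cons simp del: map_concat)
  qed simp
  then show ?thesis ..
qed

lemma upt_split: "i < m \<Longrightarrow> [0..<m] = [0..<i] @ i # [Suc i..<m]"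
  by (metis less_imp_le_nat upt_add_eq_append upt_conv_Cons zero_le le_add_diff_inverse)

lemma length_concat_map_const: "(\<And>j. j \<in> set js \<Longrightarrow> length (h j) = k) \<Longrightarrow> length (concat (map h js)) = k * length js"
  by (induction js) auto

lemma list_all2_concat_map:
  "(\<And>j. j \<in> set js \<Longrightarrow> list_all2 R (g j) (h j)) \<Longrightarrow> list_all2 R (concat (map g js)) (concat (map h js))"
  by (induction js) (auto intro: list_all2_appendI)

lemma length_unruns_concat_map_le:
  "(\<And>j. length (unruns (h j)) \<le> k) \<Longrightarrow> length (unruns (concat (map h js))) \<le> k * length js"
  by (induction js) (auto intro: add_mono)

lemma set_unruns_subset: "set (unruns ps) \<subseteq> fst ` set ps"
  by (force simp: unruns_def)

lemma alice_string_in_strings_upto: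
  assumes "0 < L" "3 * L * m \<le> n"
  shows "alice_string L m z \<in> strings_upto {0, 1, 2} n"
proof -
  have "length (alice_string L m z) \<le> 3 * L * m"
    unfolding alice_string_def
    using length_unruns_concat_map_le[of "\<lambda>j. alice_block L (z j)" "3 * L" "[0..<m]"] assms(1)
    by (simp add: alice_block_def)
  moreover have "set (alice_string L m z) \<subseteq> {0, 1, 2}"
    unfolding alice_string_def by (rule order_trans[OF set_unruns_subset]) (auto simp: alice_block_def)
  ultimately show ?thesis
    using assms by (auto simp: strings_upto_def in_lists_conv_set)
qed

lemma bob_string_in_strings_upto:
  assumes "3 * L * m \<le> n"
  shows "bob_string L m i \<in> strings_upto {0, 1, 2} n"
proof -
  have "length (bob_string L m i) \<le> 3 * L * m"
    unfolding bob_string_def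
    using length_unruns_concat_map_le[of "\<lambda>j. bob_block L (j = i)" "3 * L" "[0..<m]"]
    by (simp add: bob_block_def)
  moreover have "set (bob_string L m i) \<subseteq> {0, 1, 2}"
    unfolding bob_string_def
    by (rule order_trans[OF set_unruns_subset]) (auto simp: bob_block_def split: if_splits)
  ultimately show ?thesis
    using assms by (auto simp: strings_upto_def in_lists_conv_set)
qed

lemma DTW_alice_bob_le:
  assumes "i < m" "\<not> z i" "0 < L"
  shows "DTW (\<lambda>a b. real_of_int \<bar>a - b\<bar>) (alice_string L m z) (bob_string L m i) \<le> 1"
proof -
  let ?d = "\<lambda>a b :: int. real_of_int \<bar>a - b\<bar>"
  \<comment> \<open>Outside block \<open>i\<close> both sides expand to Bob's full block. In block
    \<open>i\<close>, Alice's single 1 is aligned with one extra 0 gained by lengthening Bob's run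
    of 0s.\<close>
  define hx where "hx j = (if j = i then [(0, L), (1, 1), (2, L)] else bob_block L False)" for j
  define hy where "hy j = (if j = i then [(0, L + 1), (2, L)] else bob_block L False)" for j
  define xb yb where "xb = unruns (concat (map hx [0..<m]))" and "yb = unruns (concat (map hy [0..<m]))"
  define u v where "u = unruns (concat (map (\<lambda>j. bob_block L False) [0..<i]))"
    and "v = unruns (concat (map (\<lambda>j. bob_block L False) [Suc i..<m]))"
  have h: "map hx [0..<i] = map (\<lambda>j. bob_block L False) [0..<i]"
    "map hx [Suc i..<m] = map (\<lambda>j. bob_block L False) [Suc i..<m]"
    "map hy [0..<i] = map (\<lambda>j. bob_block L False) [0..<i]"
    "map hy [Suc i..<m] = map (\<lambda>j. bob_block L False) [Suc i..<m]"
    by (auto simp: hx_def hy_def)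
  have hx: "unruns (hx i) = replicate L 0 @ [1] @ replicate L 2"
    and hy: "unruns (hy i) = replicate L 0 @ [0] @ replicate L 2"
    by (simp_all add: hx_def hy_def replicate_app_Cons_same)
  have xb: "xb = (u @ replicate L 0) @ [1] @ (replicate L 2 @ v)"
    and yb: "yb = (u @ replicate L 0) @ [0] @ (replicate L 2 @ v)"
    by (simp_all add: xb_def yb_def u_def v_def upt_split[OF assms(1)] hx hy h
      del: map_eq_conv)
  have "expansion (alice_string L m z) xb"
    unfolding alice_string_def xb_def using assms
    by (subst expansion_unruns_iff)
      (auto simp: alice_block_def bob_block_def hx_def intro!: distinct_adj_blocks list_all2_concat_map
        exI[of _ "concat (map hx [0..<m])"])
  moreover have "expansion (bob_string L m i) yb"
    unfolding bob_string_def yb_def using assms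
    by (subst expansion_unruns_iff)
      (auto simp: bob_block_def hy_def intro!: distinct_adj_blocks list_all2_concat_map
        exI[of _ "concat (map hy [0..<m])"] split: if_splits)
  ultimately have "(xb, yb) \<in> correspondences (alice_string L m z) (bob_string L m i)"
    by (simp add: correspondences_def xb yb)
  then have "DTW ?d (alice_string L m z) (bob_string L m i) \<le> ereal (corr_cost ?d (xb, yb))"
    unfolding DTW_def by (rule INF_lower)
  also have "corr_cost ?d (xb, yb) = corr_cost ?d ([1], [0])"
    unfolding xb yb by (subst corr_cost_append, simp, simp, subst corr_cost_append) (simp_all add: corr_cost_refl)
  also have "\<dots> = 1"
    by (simp add: corr_cost_def)
  finally show ?thesis by (simp add: one_ereal_def)
qed

lemma DTW_alice_bob_ge:
  assumes "i < m" "z i" "0 < L"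
  shows "ereal L \<le> DTW (\<lambda>a b. real_of_int \<bar>a - b\<bar>) (alice_string L m z) (bob_string L m i)"
proof -
  define A where "A js = concat (map (\<lambda>j. alice_block L (z j)) js)" for js
  define C where "C js = concat (map (\<lambda>j. bob_block L (j = i)) js)" for js
  have A: "A [0..<m] = (A [0..<i] @ [(0, 1)]) @ (1, L) # (2, 1) # A [Suc i..<m]"
    using assms(2) by (simp add: upt_split[OF assms(1)] A_def alice_block_def)
  have C: "C [0..<m] = C [0..<i] @ (0, L) # (2, L) # C [Suc i..<m]"
    by (simp add: upt_split[OF assms(1)] C_def bob_block_def)
  have len: "length (A js) = 3 * length js" for js
    unfolding A_def by (rule length_concat_map_const) (simp add: alice_block_def)
  have lenC: "length (C js) = 3 * length js" if "i \<notin> set js" for js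
    unfolding C_def using that by (intro length_concat_map_const) (auto simp: bob_block_def)
  show ?thesis
  proof (rule DTW_ge_of_long_run)
    show "alice_string L m z = unruns ((A [0..<i] @ [(0, 1)]) @ (1, L) # (2, 1) # A [Suc i..<m])"
      by (simp only: A[symmetric]) (simp add: A_def alice_string_def)
    show "distinct_adj (map fst ((A [0..<i] @ [(0, 1)]) @ (1, L) # (2, 1) # A [Suc i..<m]))"
      unfolding A[symmetric] unfolding A_def by (rule distinct_adj_blocks) (simp add: alice_block_def)
    show "\<forall>p\<in>set ((A [0..<i] @ [(0, 1)]) @ (1, L) # (2, 1) # A [Suc i..<m]). 0 < snd p"
      unfolding A[symmetric] unfolding A_def using assms by (auto simp: alice_block_def)
    show "bob_string L m i = unruns (C [0..<m])"
      by (simp add: C_def bob_string_def)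
    show "distinct_adj (map fst (C [0..<m]))"
      unfolding C_def by (rule distinct_adj_blocks) (simp add: bob_block_def)
    show "\<forall>q\<in>set (C [0..<m]). L \<le> snd q"
      by (auto simp: C_def bob_block_def split: if_splits)
    fix k assume k: "k < length (C [0..<m])" "k \<le> length (A [0..<i] @ [(0, 1)])"
      "length (C [0..<m]) \<le> k + length ((2, 1) # A [Suc i..<m]) + 1"
    \<comment> \<open>Alice has 3i + 1 runs before the long one and 3(m - i) - 2 after it, while Bob
      has 3m - 1 in all. The only indices left are those of the 0 and the 2 around the deleted
      1.\<close>
    then have "k = 3 * i \<or> k = 3 * i + 1"
      by (auto simp: C len lenC)
    then show "fst (C [0..<m] ! k) \<noteq> 1"
      by (auto simp: C lenC nth_append)
  qed (use assms in \<open>auto simp: of_bool_def\<close>)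
qed

section \<open>One-way communication complexity of the index problem\<close>

text \<open>Averaging: the expected number of events that occur is the sum of their probabilities.
  This is how the randomness gets fixed.\<close>

lemma (in prob_space) exists_point_in_many_events:
  assumes "finite I" "\<And>i. i \<in> I \<Longrightarrow> E i \<in> events" "\<And>i. i \<in> I \<Longrightarrow> p \<le> prob (E i)"
  shows "\<exists>\<omega>\<in>space M. p * card I \<le> card {i \<in> I. \<omega> \<in> E i}"
proof (rule ccontr)
  assume neg: "\<not> ?thesis"
  have count: "real (card {i \<in> I. \<omega> \<in> E i}) = (\<Sum>i\<in>I. indicator (E i) \<omega>)" for \<omega>
    using assms(1) by (simp add: indicator_def sum.If_cases Int_def)
  have int: "integrable M (\<lambda>\<omega>. \<Sum>i\<in>I. indicator (E i) \<omega> :: real)"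
    using assms(2) by (intro Bochner_Integration.integrable_sum) (auto simp: emeasure_eq_measure)
  have "p * card I \<le> (\<Sum>i\<in>I. prob (E i))"
    using sum_mono[of I "\<lambda>_. p" "\<lambda>i. prob (E i)"] assms(3) by (simp add: mult.commute)
  also have "\<dots> = expectation (\<lambda>\<omega>. \<Sum>i\<in>I. indicator (E i) \<omega>)"
    using assms(2) by (subst Bochner_Integration.integral_sum) (auto simp: emeasure_eq_measure)
  also have "\<dots> < p * card I"
    using neg by (intro expectation_less[OF int]) (auto simp: count not_le)
  finally show False by simp
qed

text \<open>Generating function of the Hamming distance to \<open>g\<close>: it factors over the
  coordinates, where agreement contributes 1 and disagreement \<open>t\<close>.\<close>

lemma sum_power_hamming_dist:
  fixes t :: "'a :: comm_semiring_1"
  shows "(\<Sum>z\<in>{..<m} \<rightarrow>\<^sub>E UNIV. t ^ card {i \<in> {..<m}. z i \<noteq> (g i :: bool)}) = (1 + t) ^ m"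
proof -
  have "t ^ card {i \<in> {..<m}. z i \<noteq> g i} = (\<Prod>i<m. if z i \<noteq> g i then t else 1)" for z
    by (subst prod.If_cases) (auto simp: Int_def)
  then have "(\<Sum>z\<in>{..<m} \<rightarrow>\<^sub>E UNIV. t ^ card {i \<in> {..<m}. z i \<noteq> g i}) =
      (\<Prod>i<m. \<Sum>b\<in>UNIV. if b \<noteq> g i then t else 1)"
    by (subst prod_sum_PiE) auto
  also have "\<dots> = (\<Prod>i<m. 1 + t)"
    by (intro prod.cong refl) (auto simp: UNIV_bool add.commute)
  finally show ?thesis by simp
qed

lemma card_bool_lists_length_le: "card {xs :: bool list. length xs \<le> n} \<le> 2 ^ Suc n"
proof -
  have "card {xs :: bool list. length xs \<le> n} = (\<Sum>i\<le>n. 2 ^ i)"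
    using card_lists_length_le[of "UNIV :: bool set" n] by simp
  also have "\<dots> \<le> 2 ^ Suc n"
    by (induction n) auto
  finally show ?thesis .
qed

lemma index_one_way_lower_bound_deterministic:
  fixes f :: "(nat \<Rightarrow> bool) \<Rightarrow> bool list" and g :: "bool list \<Rightarrow> nat \<Rightarrow> bool"
  assumes len: "\<And>z. z \<in> {..<m} \<rightarrow>\<^sub>E UNIV \<Longrightarrow> length (f z) \<le> B"
    and err: "real (\<Sum>z\<in>{..<m} \<rightarrow>\<^sub>E UNIV. card {i \<in> {..<m}. z i \<noteq> g (f z) i}) \<le> m / 10 * 2 ^ m"
  shows "7 / 15 * real m \<le> real B + 1"
proof -
  let ?Z = "{..<m} \<rightarrow>\<^sub>E (UNIV :: bool set)"
  let ?M = "{xs :: bool list. length xs \<le> B}"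
  define D where "D z w = card {i \<in> {..<m}. z i \<noteq> g w i}" for z w
  have cardZ: "card ?Z = 2 ^ m" by (simp add: card_PiE)
  have finM: "finite ?M"
    using finite_lists_length_le[of "UNIV :: bool set" B] by simp
  have pow: "(1 / 4 :: real) ^ k = exp (- ln 4 * k)" for k
    by (simp add: exp_minus exp_of_nat2_mult power_one_over inverse_eq_divide mult.commute exp_of_nat_mult)
  define e where "e = exp (- ln 4 * (real m / 10))"
  \<comment> \<open>Jensen's inequality for \<open>t \<mapsto> (1/4)\<^sup>t\<close>, via the tangent at the mean error \<open>m/10\<close>\<close>
  have tangent: "e * (1 + ln 4 * (m / 10 - real k)) \<le> (1 / 4) ^ k" for k
  proof -
    have "e * (1 + ln 4 * (m / 10 - real k)) \<le> e * exp (ln 4 * (m / 10 - real k))"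
      unfolding e_def by (intro mult_left_mono exp_ge_add_one_self) auto
    also have "\<dots> = (1 / 4) ^ k"
      unfolding e_def pow exp_add[symmetric] by (simp add: algebra_simps)
    finally show ?thesis .
  qed
  \<comment> \<open>The bound on the total error makes the added linear term nonnegative.\<close>
  have "e * 2 ^ m \<le> e * (2 ^ m + ln 4 * (m / 10 * 2 ^ m - real (\<Sum>z\<in>?Z. D z (f z))))"
    using err by (intro mult_left_mono) (auto simp: e_def D_def)
  also have "\<dots> = (\<Sum>z\<in>?Z. e * (1 + ln 4 * (m / 10 - real (D z (f z)))))"
    by (subst sum_distrib_left[symmetric], subst sum.distrib, subst sum_distrib_left[symmetric],
        subst sum_subtractf) (simp add: cardZ)
  also have "\<dots> \<le> (\<Sum>z\<in>?Z. (1 / 4) ^ D z (f z))"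
    by (intro sum_mono tangent)
  \<comment> \<open>Summing over all short messages, not just the one sent, removes the dependence
    on \<open>f\<close>; the sums can then be swapped.\<close>
  also have "\<dots> \<le> (\<Sum>z\<in>?Z. \<Sum>w\<in>?M. (1 / 4) ^ D z w)"
    using len finM by (intro sum_mono member_le_sum) auto
  also have "\<dots> = (\<Sum>w\<in>?M. \<Sum>z\<in>?Z. (1 / 4) ^ D z w)"
    by (rule sum.swap)
  also have "\<dots> = card ?M * (5 / 4) ^ m"
    unfolding D_def sum_power_hamming_dist by simp
  also have "\<dots> \<le> 2 ^ Suc B * (5 / 4) ^ m"
    using of_nat_mono[OF card_bool_lists_length_le[of B], where 'a = real] by (intro mult_right_mono) simp_all
  finally have main: "e * 2 ^ m \<le> 2 ^ Suc B * (5 / 4) ^ m" .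
  \<comment> \<open>(5/4)^3 = 125/64 is below 2. The final constant is then 1 - 2/10 - 1/3 =
    7/15.\<close>
  have "ln (5 / 4 :: real) * 3 = ln ((5 / 4) ^ 3)"
    by (subst ln_realpow) auto
  also have "\<dots> \<le> ln 2"
    by (subst ln_le_cancel_iff) (auto simp: power3_eq_cube)
  finally have ln54: "ln (5 / 4 :: real) \<le> ln 2 / 3" by simp
  have ln4: "ln (4 :: real) = 2 * ln 2"
    using ln_realpow[of "2::real" 2] by simp
  have "ln (e * 2 ^ m) \<le> ln (2 ^ Suc B * (5 / 4) ^ m)"
    using main by (subst ln_le_cancel_iff) (auto simp: e_def)
  then have "- ln 4 * (real m / 10) + m * ln 2 \<le> (real B + 1) * ln 2 + m * ln (5 / 4)"
    by (simp add: ln_mult ln_realpow e_def algebra_simps del: power_Suc)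
  also have "\<dots> \<le> (real B + 1) * ln 2 + m * (ln 2 / 3)"
    using ln54 by (intro add_left_mono mult_left_mono) auto
  finally have "(7 / 15 * m) * ln 2 \<le> (real B + 1) * ln (2::real)"
    by (simp add: ln4 field_simps)
  then show ?thesis by simp
qed

text \<open>The guarantee for each pair \<open>(z, i)\<close> is averaged over all pairs, so that
  one \<open>\<omega>\<close> serves at least nine tenths of them and the deterministic bound
  applies.\<close>

lemma (in prob_space) index_one_way_lower_bound:
  fixes f :: "'a \<Rightarrow> (nat \<Rightarrow> bool) \<Rightarrow> bool list" and g :: "'a \<Rightarrow> bool list \<Rightarrow> nat \<Rightarrow> bool"
  assumes len: "\<And>\<omega> z. \<omega> \<in> space M \<Longrightarrow> z \<in> {..<m} \<rightarrow>\<^sub>E UNIV \<Longrightarrow> length (f \<omega> z) \<le> B"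
    and E: "\<And>z i. z \<in> {..<m} \<rightarrow>\<^sub>E UNIV \<Longrightarrow> i < m \<Longrightarrow> 0.9 \<le> prob (E z i)"
    and correct: "\<And>z i \<omega>. z \<in> {..<m} \<rightarrow>\<^sub>E UNIV \<Longrightarrow> i < m \<Longrightarrow> \<omega> \<in> E z i \<Longrightarrow> g \<omega> (f \<omega> z) i = z i"
  shows "7 / 15 * real m \<le> real B + 1"
proof -
  let ?Z = "{..<m} \<rightarrow>\<^sub>E (UNIV :: bool set)"
  have finZ: "finite ?Z" by (intro finite_PiE) auto
  have cardZ: "card ?Z = 2 ^ m" by (simp add: card_PiE)
  have "\<exists>\<omega>\<in>space M. 0.9 * card (?Z \<times> {..<m})
      \<le> card {zi \<in> ?Z \<times> {..<m}. \<omega> \<in> (\<lambda>(z, i). E z i) zi}"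
  proof (intro exists_point_in_many_events)
    fix zi assume "zi \<in> ?Z \<times> {..<m}"
    then show le: "0.9 \<le> prob ((\<lambda>(z, i). E z i) zi)"
      using E by auto
    \<comment> \<open>Non-measurable sets have measure 0, so the probability bound forces
      measurability.\<close>
    show "(\<lambda>(z, i). E z i) zi \<in> events"
      using le measure_notin_sets[of "(\<lambda>(z, i). E z i) zi" M] by force
  qed (use finZ in auto)
  then obtain \<omega> where \<omega>: "\<omega> \<in> space M"
      "0.9 * card (?Z \<times> {..<m}) \<le> card {zi \<in> ?Z \<times> {..<m}. \<omega> \<in> (\<lambda>(z, i). E z i) zi}"
    by blast
  let ?G = "{zi \<in> ?Z \<times> {..<m}. g \<omega> (f \<omega> (fst zi)) (snd zi) = fst zi (snd zi)}"
  let ?W = "{zi \<in> ?Z \<times> {..<m}. g \<omega> (f \<omega> (fst zi)) (snd zi) \<noteq> fst zi (snd zi)}"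
  have "card {zi \<in> ?Z \<times> {..<m}. \<omega> \<in> (\<lambda>(z, i). E z i) zi} \<le> card ?G"
    using finZ correct by (intro card_mono) auto
  moreover have "card ?G + card ?W = card (?Z \<times> {..<m})"
  proof (subst card_Un_disjoint[symmetric])
    show "card (?G \<union> ?W) = card (?Z \<times> {..<m})"
      by (rule arg_cong[where f = card]) blast
  qed (use finZ in auto)
  ultimately have "real (card ?W) \<le> 0.1 * card (?Z \<times> {..<m})"
    using \<omega>(2) by linarith
  moreover have "?W = Sigma ?Z (\<lambda>z. {i \<in> {..<m}. z i \<noteq> g \<omega> (f \<omega> z) i})"
    unfolding set_eq_iff split_paired_All mem_Collect_eq mem_Sigma_iff fst_conv snd_conv by metis
  then have "card ?W = (\<Sum>z\<in>?Z. card {i \<in> {..<m}. z i \<noteq> g \<omega> (f \<omega> z) i})"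
    using finZ by (simp only: card_SigmaI) simp
  moreover have "real (card (?Z \<times> {..<m})) = m * 2 ^ m"
    by (simp add: cardZ card_cartesian_product)
  ultimately have err: "real (\<Sum>z\<in>?Z. card {i \<in> {..<m}. z i \<noteq> g \<omega> (f \<omega> z) i}) \<le> m / 10 * 2 ^ m"
    by (simp only:) simp
  show ?thesis
    by (rule index_one_way_lower_bound_deterministic[where f = "f \<omega>" and g = "g \<omega>", OF len[OF \<omega>(1)] err])
qed

section \<open>The lower bound for DTEP\<close>

text \<open>Covers small \<open>m\<close>, where the index bound says nothing. If all messages are
  empty, Bob holding \<open>[a]\<close> cannot tell \<open>[]\<close> from \<open>[a]\<close>,
  although the distances, infinite and at most 0, demand different answers.\<close>

lemma DTEP_message_length_ge_1:
  fixes P :: "('a list, 'a list, nat) one_way_protocol"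
  assumes acc: "DTEP_accurate 0.9 d 1 \<alpha> \<Sigma> n P"
    and a: "a \<in> \<Sigma>" "d a a = 0"
    and "1 \<le> n" "0 \<le> \<alpha>"
    and len: "\<And>\<omega> x. \<omega> \<in> space (public_rand P) \<Longrightarrow> x \<in> strings_upto \<Sigma> n \<Longrightarrow>
      length (message P \<omega> x) \<le> B"
  shows "1 \<le> B"
proof (rule ccontr)
  let ?E = "\<lambda>x. {\<omega> \<in> space (public_rand P). DTEP_valid d 1 \<alpha> x [a] (answer P \<omega> (message P \<omega> x) [a])}"
  assume "\<not> 1 \<le> B"
  interpret prob_space "public_rand P"
    using acc by (simp add: DTEP_accurate_def accurate_def)
  have str: "[] \<in> strings_upto \<Sigma> n" "[a] \<in> strings_upto \<Sigma> n"
    using a(1) assms(4) by (auto simp: strings_upto_def)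
  have "expansion [a] [a]"
    by (auto simp: expansion_def intro!: exI[of _ "[[a]]"] exI[of _ "0::nat"])
  then have "([a], [a]) \<in> correspondences [a] [a]"
    by (simp add: correspondences_def)
  then have "DTW d [a] [a] \<le> ereal (corr_cost d ([a], [a]))"
    unfolding DTW_def by (rule INF_lower)
  then have DTW0: "DTW d [a] [a] \<le> 0"
    by (simp add: corr_cost_def zero_ereal_def a(2))
  have "correspondences [] [a] = {}"
    by (auto simp: correspondences_def expansion_def list_all2_Cons1)
  then have DTW_inf: "DTW d [] [a] = \<infinity>"
    by (simp add: DTW_def top_ereal_def)
  have "DTW d [a] [a] \<le> ereal 1"
    by (rule order_trans[OF DTW0]) simp
  then have "\<exists>b. DTEP_valid d 1 \<alpha> [a] [a] b" "\<exists>b. DTEP_valid d 1 \<alpha> [] [a] b"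
    by (auto simp: DTEP_valid_def DTW_inf)
  then have prob: "0.9 \<le> prob (?E [a])" "0.9 \<le> prob (?E [])"
    using acc str by (auto simp: DTEP_accurate_def accurate_def)
  then have ev: "?E [a] \<in> events" "?E [] \<in> events"
    using measure_notin_sets[of "?E [a]" "public_rand P"] measure_notin_sets[of "?E []" "public_rand P"]
    by force+
  have "\<not> ereal \<alpha> < DTW d [a] [a]"
    using order_trans[OF DTW0, of "ereal \<alpha>"] assms(5) by (simp add: not_less)
  moreover have msg: "message P \<omega> [] = []" "message P \<omega> [a] = []" if "\<omega> \<in> space (public_rand P)" for \<omega>
    using \<open>\<not> 1 \<le> B\<close> len[OF that str(1)] len[OF that str(2)] by (simp_all add: not_le)
  \<comment> \<open>Both inputs get the same answer, but only 0 is valid for \<open>[a]\<close> and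
    only 1 for \<open>[]\<close>. Two disjoint events of probability 0.9 cannot coexist.\<close>
  ultimately have "?E [a] \<inter> ?E [] = {}"
    using msg by (auto simp: DTEP_valid_def DTW_inf)
  then have "prob (?E [a]) + prob (?E []) = prob (?E [a] \<union> ?E [])"
    using ev by (simp add: finite_measure_Union)
  then show False
    using prob prob_le_1[of "?E [a] \<union> ?E []"] by linarith
qed

theorem theorem5p1:
  shows "\<exists>c>0. \<forall>(n::nat) (\<alpha>::real) (P :: (int list, int list, nat) one_way_protocol).
           1 \<le> \<alpha> \<and> \<alpha> \<le> real n \<and>
           DTEP_accurate 0.9 (\<lambda>a b. real_of_int \<bar>a - b\<bar>) 1 \<alpha> {0, 1, 2} n P \<longrightarrow>
           ereal_of_enat (bit_complexity (strings_upto {0, 1, 2} n) P) \<ge> ereal (c * (real n / \<alpha>))"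
proof (rule exI[of _ "1 / 32"], intro conjI allI impI)
  fix n :: nat and \<alpha> :: real and P :: "(int list, int list, nat) one_way_protocol"
  define d where "d = (\<lambda>a b :: int. real_of_int \<bar>a - b\<bar>)"
  assume "1 \<le> \<alpha> \<and> \<alpha> \<le> real n \<and>
    DTEP_accurate 0.9 (\<lambda>a b. real_of_int \<bar>a - b\<bar>) 1 \<alpha> {0, 1, 2} n P"
  then have \<alpha>: "1 \<le> \<alpha>" "\<alpha> \<le> real n" and acc: "DTEP_accurate 0.9 d 1 \<alpha> {0, 1, 2} n P"
    unfolding d_def by blast+
  let ?S = "strings_upto {0, 1, 2 :: int} n"
  show "ereal (1 / 32 * (real n / \<alpha>)) \<le> ereal_of_enat (bit_complexity ?S P)"
  proof (cases "bit_complexity ?S P")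
    case (enat B)
    have len: "length (message P \<omega> x) \<le> B" if "\<omega> \<in> space (public_rand P)" "x \<in> ?S" for \<omega> x
    proof -
      have "enat (length (message P \<omega> x)) \<le> bit_complexity ?S P"
        unfolding bit_complexity_def using that by (intro SUP_upper2[of \<omega>] SUP_upper2[of x]) auto
      then show ?thesis by (simp add: enat)
    qed
    have "1 \<le> B"
      by (rule DTEP_message_length_ge_1[OF acc, of 0]) (use \<alpha> len in \<open>auto simp: d_def\<close>)
    interpret prob_space "public_rand P"
      using acc by (simp add: DTEP_accurate_def accurate_def)
    \<comment> \<open>\<open>L\<close> is the least integer above \<open>\<alpha>\<close>, so a cost
      of \<open>L\<close> exceeds the threshold. As \<open>L\<close> is at most twice
      \<open>\<alpha>\<close>, the choice of \<open>m\<close> keeps 3Lm within n.\<close>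
    define L where "L = nat \<lfloor>\<alpha>\<rfloor> + 1"
    define m where "m = nat \<lfloor>n / (6 * \<alpha>)\<rfloor>"
    have L: "\<alpha> < L" "L \<le> 2 * \<alpha>" "0 < L"
      unfolding L_def using \<alpha>(1) by linarith+
    have m: "m \<le> n / (6 * \<alpha>)" "n / (6 * \<alpha>) < m + 1"
      unfolding m_def using \<alpha> by (auto simp: of_nat_floor) linarith
    have "real (3 * L * m) \<le> 6 * \<alpha> * m"
      using L(2) mult_right_mono[of "3 * real L" "6 * \<alpha>" "real m"] by simp
    also have "\<dots> \<le> n"
      using m(1) \<alpha>(1) by (simp add: field_simps)
    finally have size: "3 * L * m \<le> n"
      by linarith
    have a: "alice_string L m z \<in> ?S" and b: "bob_string L m i \<in> ?S" for z i
      using size L(3) by (simp_all add: alice_string_in_strings_upto bob_string_in_strings_upto)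
    \<comment> \<open>Exactly one output is valid on each of these pairs, so the promise holds and a
      valid answer reveals the bit.\<close>
    have valid_iff: "DTEP_valid d 1 \<alpha> (alice_string L m z) (bob_string L m i) v \<longleftrightarrow> v = of_bool (z i)"
      if "i < m" for z i v
    proof (cases "z i")
      case True
      have "ereal \<alpha> < ereal L" using L(1) by simp
      also have "\<dots> \<le> DTW d (alice_string L m z) (bob_string L m i)"
        using DTW_alice_bob_ge[of i m z L, folded d_def] that True L(3) by simp
      finally have lt: "ereal \<alpha> < DTW d (alice_string L m z) (bob_string L m i)" .
      have "ereal 1 \<le> ereal \<alpha>" using \<alpha>(1) by simp
      then have "ereal 1 < DTW d (alice_string L m z) (bob_string L m i)"
        using lt by (rule order_le_less_trans)
      then show ?thesis
        using lt True by (auto simp: DTEP_valid_def not_le[symmetric])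
    next
      case False
      have le: "DTW d (alice_string L m z) (bob_string L m i) \<le> ereal 1"
        using DTW_alice_bob_le[of i m z L, folded d_def] that False L(3) by (simp add: one_ereal_def)
      also have "ereal 1 \<le> ereal \<alpha>" using \<alpha>(1) by simp
      finally show ?thesis
        using le False by (auto simp: DTEP_valid_def not_less[symmetric])
    qed
    have "7 / 15 * real m \<le> real B + 1"
    proof (rule index_one_way_lower_bound)
      show "length (message P \<omega> (alice_string L m z)) \<le> B" if "\<omega> \<in> space (public_rand P)" for \<omega> z
        using that a by (rule len)
      let ?E = "\<lambda>z i. {\<omega> \<in> space (public_rand P). DTEP_valid d 1 \<alpha> (alice_string L m z) (bob_string L m i)
          (answer P \<omega> (message P \<omega> (alice_string L m z)) (bob_string L m i))}"
      show "0.9 \<le> prob (?E z i)" if "i < m" for z i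
        using acc a b valid_iff[OF that] unfolding DTEP_accurate_def accurate_def by blast
      show "(answer P \<omega> (message P \<omega> (alice_string L m z)) (bob_string L m i) = 1) = z i"
        if "i < m" "\<omega> \<in> ?E z i" for z i \<omega>
        using that by (simp add: valid_iff)
    qed
    then have "7 * real m \<le> 15 * real B + 15"
      by simp
    moreover have "1 \<le> real B"
      using \<open>1 \<le> B\<close> by simp
    \<comment> \<open>Since B is at least 1, 6(m + 1) is at most (90B + 132)/7, hence at most
      222B/7, which is below 32B.\<close>
    ultimately have "6 * (real m + 1) \<le> 32 * real B"
      by simp
    moreover have "n / \<alpha> < 6 * (real m + 1)"
      using m(2) \<alpha>(1) by (simp add: field_simps)
    ultimately have "n / \<alpha> \<le> 32 * real B"
      by linarith
    then show ?thesis
      by (simp add: enat)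
  qed simp
qed simp

end
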